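(* Let $f,g\in\mathbb{K}[x]$ be monic polynomials of degrees $m$ and $n$, with multisets of roots $A,B\subset\mathbb{K}$ respectively (so $f=\prod_{a\in A}(x-a)$, $g=\prod_{b\in B}(x-b)$, products with multiplicity). Let $\overline A$ and $\overline B$ be subsets of the sets of distinct roots of $f$ and $g$, respectively, and set $m':=m-|\overline A|$ and $n':=n-|\overline B|$. For any $d$ such that $m'+n'\le d\le\min\{m,n\}$ if $m\ne n$, or $m'+n'\le d<m=n$, we have $$\operatorname{Sres}_d(f,g)(x)=(-1)^{d(m-d)}\operatorname{SylM}_d(A,B)(x).$$
   Context: $\mathbb{K}$ is a field. For a multiset $X$, $|X|$ is the number of elements counted with multiplicity; for multisets $X'\subset X$, $X\backslash X'$ is the multiset difference (multiplicities subtracted). For multisets $X,Y$, $\mathcal{R}(X,Y):=\prod_{x\in X,\,y\in Y}(x-y)$ (with multiplicities), equal to $1$ if $X$ or $Y$ is empty; $\mathcal{R}(x,Y):=\mathcal{R}(\{x\},Y)$. Subresultant: for $f=f_mx^m+\cdots+f_0$ and $g=g_nx^n+\cdots+g_0$, and $0\le d\le\min\{m,n\}$ if $m\neq n$ or $0\le d<m=n$, $\operatorname{Sres}_d(f,g)(x)\in\mathbb{K}[x]$ is the determinant of the following square matrix of size $m+n-2d$ (coefficients with index outside the range are $0$): for $1\le i\le n-d$, row $i$ has entry $f_{m+i-j}$ in column $j$ for $1\le j\le m+n-2d-1$ and entry $x^{n-d-i}f(x)$ in the last column; for $1\le i\le m-d$, row $n-d+i$ has entry $g_{n+i-j}$ in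 column $j$ for $1\le j\le m+n-2d-1$ and entry $x^{m-d-i}g(x)$ in the last column. Sylvester sum for multisets, for $d$ in the stated range: $$\operatorname{SylM}_{d}(A,B)(x):=(-1)^{m'(m-d)}\sum_{\substack{A'\subset\overline A\\|A'|=d-m'}}\ \sum_{\substack{B'\subset\overline B\\|B'|=m'}}\frac{\mathcal{R}(A\backslash\overline A,\overline B\backslash B')\,\mathcal{R}(\overline A\backslash A',B\backslash B')\,\mathcal{R}(x,A')\,\mathcal{R}(x,B')}{\mathcal{R}(A',\overline A\backslash A')\,\mathcal{R}(B',\overline B\backslash B')}.$$ (It depends a priori on the choice of $\overline A,\overline B$.) *)

theory Defs
  imports "Subresultants.Subresultant" "HOL-Library.Multiset"
begin

text \<open>
  \<open>Sres\<^sub>d(f,g)\<close> is the library's \<open>subresultant d f g\<close>, whose matrix is the transpose of the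
  row-wise matrix below (here \<open>m\<close> and \<open>n\<close> are the degrees of \<open>f\<close> and \<open>g\<close>, and \<open>i\<close>, \<open>j\<close> start
  at 0, so that coefficient \<open>f\<^sub>k\<close> with \<open>k = m + (i + 1) - (j + 1)\<close> appears in row \<open>i\<close>, column
  \<open>j\<close>; \<open>coeff_int\<close> is 0 at negative indices).
\<close>

lemma subresultant_eq_det_rows:
  fixes f g :: "'a :: comm_ring_1 poly" and d :: nat
  defines "m \<equiv> degree f" and "n \<equiv> degree g"
  defines "N \<equiv> (m - d) + (n - d)"
  shows "subresultant d f g = det (mat N N (\<lambda>(i, j).
           if i < n - d
           then if j = N - 1 then monom 1 (n - d - 1 - i) * f
                else [: coeff_int f (int m + int i - int j) :]
           else let i' = i - (n - d) in
                if j = N - 1 then monom 1 (m - d - 1 - i') * g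
                else [: coeff_int g (int n + int i' - int j) :]))"
    (is "_ = det ?M")
proof -
  have "subresultant_mat d f g = transpose_mat ?M"
  proof (rule eq_matI)
    fix i j
    assume ij: "i < dim_row (transpose_mat ?M)" "j < dim_col (transpose_mat ?M)"
    have e: "x + y - z = x - z + y" for x y z :: int by simp
    from ij have ij': "i < N" "j < N"
      by (simp_all add: N_def m_def n_def)
    have "transpose_mat ?M $$ (i, j) = ?M $$ (j, i)"
      by (rule index_transpose_mat(1)) (use ij' in simp_all)
    also have "\<dots> = subresultant_mat d f g $$ (i, j)"
      unfolding index_mat(1)[OF ij'(2,1)] split Let_def
        subresultant_index_mat[OF ij'[unfolded N_def m_def n_def], folded m_def n_def, folded N_def]
      by (simp only: e)
    finally show "subresultant_mat d f g $$ (i, j) = transpose_mat ?M $$ (i, j)" ..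
  qed (simp_all add: N_def m_def n_def)
  moreover have "det (transpose_mat ?M) = det ?M"
    by (rule det_transpose[of _ N]) simp
  ultimately show ?thesis
    by (simp only: subresultant_def)
qed

definition root_diff_prod :: "'a :: comm_ring_1 multiset \<Rightarrow> 'a multiset \<Rightarrow> 'a" where
  "root_diff_prod X Y = (\<Prod>x\<in>#X. \<Prod>y\<in>#Y. x - y)"

text \<open>\<open>\<R>(x, Y)\<close> for the indeterminate \<open>x\<close>; the product is taken in the polynomial ring.\<close>

definition root_diff_poly :: "'a :: comm_ring_1 multiset \<Rightarrow> 'a poly" where
  "root_diff_poly Y = root_diff_prod {#[:0, 1:]#} (image_mset (\<lambda>y. [:y:]) Y)"

text \<open>
  The Sylvester sum depends on the chosen sets \<open>Abar\<close>, \<open>Bbar\<close> of distinct elements of \<open>A\<close>, \<open>B\<close>.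
  The subtractions of natural numbers below are exact when \<open>Abar \<subseteq> set_mset A\<close> and
  \<open>m' \<le> d \<le> size A\<close>, where \<open>m' = size A - card Abar\<close>.
\<close>

definition SylM ::
    "'a :: field set \<Rightarrow> 'a set \<Rightarrow> nat \<Rightarrow> 'a multiset \<Rightarrow> 'a multiset \<Rightarrow> 'a poly" where
  "SylM Abar Bbar d A B =
    (let m = size A; m' = m - card Abar in
     (-1) ^ (m' * (m - d)) *
     (\<Sum>A'\<in>{A'. A' \<subseteq> Abar \<and> card A' = d - m'}. \<Sum>B'\<in>{B'. B' \<subseteq> Bbar \<and> card B' = m'}.
       smult
         (root_diff_prod (A - mset_set Abar) (mset_set (Bbar - B')) *
          root_diff_prod (mset_set (Abar - A')) (B - mset_set B') /
          (root_diff_prod (mset_set A') (mset_set (Abar - A')) *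
           root_diff_prod (mset_set B') (mset_set (Bbar - B'))))
         (root_diff_poly (mset_set A') * root_diff_poly (mset_set B'))))"

end

theory Submission
  imports Defs
begin

text \<open>
  Split off the chosen simple roots: \<open>f = f0 * root_poly X\<close> and \<open>g = g0 * root_poly Y\<close>, where \<open>X\<close>
  and \<open>Y\<close> are the two chosen sets and \<open>f0\<close>, \<open>g0\<close> are monic of degrees \<open>m'\<close> and \<open>n'\<close>. The idea is to
  regard both sides as polynomials of degree at most \<open>d\<close> in \<open>x\<close> and to compare their values on
  \<open>X \<union> Y\<close>.

  If \<open>f = (x - a) f1\<close>, then row and column operations in the determinant show that the value of
  \<open>Sres\<^sub>d(f, g)\<close> at \<open>a\<close> is \<open>g(a)\<close> times the principal coefficient (the formal coefficient of \<open>x\<^sup>d\<close>) of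
  \<open>Sres\<^sub>d(f1, g)\<close> (lemma \<open>poly_subresultant_at_root\<close>). By the symmetry of subresultants there is a
  similar formula at a root of \<open>g\<close>. The Sylvester sum satisfies the same two recursions, because at
  \<open>a \<in> X\<close> only the terms whose subset of \<open>X\<close> avoids \<open>a\<close> survive, and these are multiples of the terms
  for \<open>X - {a}\<close> (lemmas \<open>poly_sylv_poly_left\<close> and \<open>poly_sylv_poly_right\<close>). So, by induction on the
  number of chosen roots, both sides agree on \<open>X \<union> Y\<close>. If \<open>X\<close> and \<open>Y\<close> are disjoint, the hypothesis
  \<open>m' + n' \<le> d\<close> provides at least \<open>m + n - d > d\<close> points, and the two polynomials are equal. In
  the boundary cases, where the reduced problem leaves the admissible range of \<open>d\<close>, the leading
  coefficient of its Sylvester sum is 0 or 1: the sum is empty or a Lagrange interpolation identity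
  (lemma \<open>lagrange_sum\<close>) evaluates it.

  If \<open>X\<close> and \<open>Y\<close> have common elements, there are too few points. Then \<open>X\<close> is translated by an
  indeterminate \<open>t\<close>; the identity holds over the field of rational functions in \<open>t\<close>, contains no
  denominators in \<open>t\<close>, and specialises to \<open>t = 0\<close> (lemma \<open>subresultant_eq_sylv_poly\<close>).
\<close>

section \<open>Products over pairs of finite sets\<close>

definition root_poly :: "'a :: comm_ring_1 set \<Rightarrow> 'a poly" where
  "root_poly X = (\<Prod>a\<in>X. [:- a, 1:])"

definition diff_prod :: "'a :: comm_ring_1 set \<Rightarrow> 'a set \<Rightarrow> 'a" where
  "diff_prod X Y = (\<Prod>x\<in>X. \<Prod>y\<in>Y. x - y)"

abbreviation ksubsets :: "'a set \<Rightarrow> nat \<Rightarrow> 'a set set" where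
  "ksubsets X k \<equiv> {S. S \<subseteq> X \<and> card S = k}"

lemma root_poly_monic: "lead_coeff (root_poly X :: 'a :: idom poly) = 1"
  by (simp add: root_poly_def lead_coeff_prod)

lemma root_poly_nonzero [simp]: "(root_poly X :: 'a :: idom poly) \<noteq> 0"
  using root_poly_monic[of X] by (metis coeff_0 zero_neq_one)

lemma degree_root_poly: "degree (root_poly X :: 'a :: idom poly) = card X"
  unfolding root_poly_def by (subst degree_prod_eq_sum_degree) auto

lemma poly_root_poly: "poly (root_poly X) a = (\<Prod>x\<in>X. a - x)"
  by (simp add: root_poly_def poly_prod)

lemma root_poly_insert:
  assumes "finite X" "a \<notin> X"
  shows "root_poly (insert a X) = [:- a, 1:] * root_poly X"
  using assms by (simp add: root_poly_def)

lemma diff_prod_insert_left: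
  assumes "finite X" "a \<notin> X"
  shows "diff_prod (insert a X) Y = poly (root_poly Y) a * diff_prod X Y"
  using assms by (simp add: diff_prod_def poly_root_poly)

text \<open>
  The sign turns the factors \<open>x - b\<close> into values at \<open>b\<close>; signs of this kind are the source of
  the powers of \<open>-1\<close> in the Sylvester sum.
\<close>

lemma diff_prod_insert_right:
  assumes "finite Y" "b \<notin> Y"
  shows "diff_prod X (insert b Y) = (-1) ^ card X * poly (root_poly X) b * diff_prod X Y"
proof -
  have "(\<Prod>x\<in>X. x - b) = (\<Prod>x\<in>X. (-1) * (b - x))" by simp
  also have "\<dots> = (-1) ^ card X * poly (root_poly X) b"
    by (simp only: prod.distrib prod_constant poly_root_poly)
  finally show ?thesis using assms by (simp add: diff_prod_def prod.distrib)
qed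

lemma diff_prod_empty [simp]: "diff_prod {} Y = 1" "diff_prod X {} = 1"
  by (simp_all add: diff_prod_def)

text \<open>
  For use with summands that contain the factor \<open>root_poly S\<close>, evaluated at \<open>a\<close>.
\<close>

lemma sum_ksubsets_insert:
  fixes F :: "'a set \<Rightarrow> 'b :: comm_monoid_add"
  assumes "finite X" "\<And>S. finite S \<Longrightarrow> a \<in> S \<Longrightarrow> F S = 0"
  shows "(\<Sum>S\<in>ksubsets (insert a X) k. F S) = (\<Sum>S\<in>ksubsets X k. F S)"
  by (rule sum.mono_neutral_right) (use assms finite_subset[of _ "insert a X"] in auto)

section \<open>Lagrange interpolation sums\<close>

lemma poly_eqI_card:
  fixes p q :: "'a :: idom poly"
  assumes "degree p < card X" "degree q < card X" "\<And>x. x \<in> X \<Longrightarrow> poly p x = poly q x"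
  shows "p = q"
proof (rule ccontr)
  assume "p \<noteq> q"
  then have nz: "p - q \<noteq> 0" by simp
  have "card X \<le> card {x. poly (p - q) x = 0}"
    by (rule card_mono) (use assms(3) poly_roots_finite[OF nz] in auto)
  also have "\<dots> \<le> degree (p - q)" by (rule card_poly_roots_bound[OF nz])
  also have "\<dots> < card X" by (rule degree_diff_less[OF assms(1,2)])
  finally show False by simp
qed

text \<open>
  If the coefficients of this sum are attached to the polynomials \<open>root_poly S\<close>, the value at a
  point \<open>x \<in> X\<close> is \<open>(-1)\<^sup>k z(x)\<close> times the same sum for \<open>X - {x}\<close>, so by induction the resulting
  polynomial is a known multiple of \<open>z\<close>: both have degree at most \<open>k\<close> and they agree at more than
  \<open>k\<close> points. Comparing the coefficients of \<open>x\<^sup>k\<close> gives the sum. Two cases matter below: the sum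
  vanishes if \<open>degree z < k < card X\<close>, and it is 1 if \<open>z\<close> has degree \<open>k\<close> and leading coefficient
  \<open>(-1)\<^sup>k\<close>.
\<close>

lemma lagrange_sum:
  fixes z :: "'a :: field poly"
  assumes "finite X" "k \<le> card X" "degree z \<le> k"
  shows "(\<Sum>S\<in>ksubsets X k. (\<Prod>x\<in>X - S. poly z x) / diff_prod S (X - S))
         = ((-1) ^ k * coeff z k) ^ (card X - k)"
  using assms(1,2)
proof (induction "card X" arbitrary: X rule: less_induct)
  case less
  let ?c = "\<lambda>X S. (\<Prod>x\<in>X - S. poly z x) / diff_prod S (X - S)"
  show ?case
  proof (cases "card X = k")
    case True
    then have "ksubsets X k = {X}"
      using card_subset_eq[OF less.prems(1)] by auto
    then show ?thesis using True by simp
  next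
    case False
    then have gt: "k < card X" using less.prems by simp
    define Q where "Q = (\<Sum>S\<in>ksubsets X k. smult (?c X S) (root_poly S))"
    define e where "e = ((-1) ^ k * coeff z k) ^ (card X - k - 1)"
    have degQ: "degree Q \<le> k" unfolding Q_def
      by (rule degree_sum_le) (use less.prems(1) in \<open>auto simp: degree_root_poly\<close>)
    have "Q = smult ((-1) ^ k * e) z"
    proof (rule poly_eqI_card)
      fix x assume x: "x \<in> X"
      define Y where "Y = X - {x}"
      have Y: "X = insert x Y" "x \<notin> Y" "finite Y" "card Y = card X - 1"
        using x less.prems(1) by (auto simp: Y_def)
      have "poly Q x = (\<Sum>S\<in>ksubsets X k. ?c X S * poly (root_poly S) x)"
        by (simp add: Q_def poly_sum)
      also have "\<dots> = (\<Sum>S\<in>ksubsets Y k. ?c X S * poly (root_poly S) x)"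
        unfolding Y(1)
        by (rule sum_ksubsets_insert)
          (use Y(3) in \<open>auto simp: poly_root_poly intro!: prod_zero\<close>)
      also have "\<dots> = (\<Sum>S\<in>ksubsets Y k. (-1) ^ k * poly z x * ?c Y S)"
      proof (rule sum.cong[OF refl])
        fix S assume S: "S \<in> ksubsets Y k"
        have S': "finite S" "X - S = insert x (Y - S)" "x \<notin> Y - S" "x \<notin> S"
          using S Y finite_subset by auto
        have nz: "poly (root_poly S) x \<noteq> 0" using S' by (auto simp: poly_root_poly)
        have "1 / (-1) ^ k = ((-1) ^ k :: 'a)"
          by (simp add: minus_one_power_iff)
        then have "u / ((-1) ^ k * v) = (-1) ^ k * (u / v)" for u v :: 'a
          by (metis divide_divide_eq_left' mult.commute mult_1 times_divide_eq_left)
        then show "?c X S * poly (root_poly S) x = (-1) ^ k * poly z x * ?c Y S"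
          using nz S S' Y by (simp add: diff_prod_insert_right)
      qed
      also have "\<dots> = (-1) ^ k * poly z x * e"
        unfolding sum_distrib_left[symmetric]
        by (subst less.hyps) (use Y gt in \<open>auto simp: e_def\<close>)
      finally show "poly Q x = poly (smult ((-1) ^ k * e) z) x" by simp
    qed (use gt degQ assms(3) in \<open>auto intro: le_less_trans[OF degree_smult_le]\<close>)
    then have "coeff Q k = (-1) ^ k * coeff z k * e" by simp
    also have "\<dots> = ((-1) ^ k * coeff z k) ^ (card X - k)"
      using gt by (simp add: e_def power_Suc[symmetric] Suc_diff_Suc del: power_Suc)
    also have "coeff Q k = (\<Sum>S\<in>ksubsets X k. ?c X S)"
      unfolding Q_def coeff_sum coeff_smult
    proof (rule sum.cong[OF refl])
      fix S assume "S \<in> ksubsets X k"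
      then have "k = degree (root_poly S)" by (simp add: degree_root_poly)
      then have "coeff (root_poly S) k = 1" using root_poly_monic[of S] by simp
      then show "?c X S * coeff (root_poly S) k = ?c X S" by simp
    qed
    finally show ?thesis .
  qed
qed

section \<open>Values of subresultants at roots\<close>

text \<open>
  The principal subresultant coefficient. It differs from \<open>coeff (subresultant d f g) d\<close> only for
  \<open>degree f \<le> d\<close> and \<open>degree g \<le> d\<close>, when both determinants are empty: \<open>psc d f g\<close> is then 1, which
  is the value that the recursion \<open>poly_subresultant_at_root\<close> needs.
\<close>

definition psc :: "nat \<Rightarrow> 'a :: comm_ring_1 poly \<Rightarrow> 'a poly \<Rightarrow> 'a" where
  "psc d f g = det (subresultant'_mat d d f g)"

lemma coeff_subresultant_eq_psc:
  assumes "\<not> (degree f \<le> d \<and> degree g \<le> d)"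
  shows "coeff (subresultant d f g) d = psc d f g"
  using assms by (auto simp: coeff_subresultant psc_def)

lemma psc_eq_1:
  assumes "degree f \<le> d" "degree g \<le> d"
  shows "psc d f g = 1"
  using assms by (simp add: psc_def subresultant'_mat_def Let_def)

lemma degree_subresultant_le:
  assumes "d \<le> degree f" "d \<le> degree g" "\<not> (degree f \<le> d \<and> degree g \<le> d)"
  shows "degree (subresultant d f g) \<le> d"
proof (rule degree_le, intro allI impI)
  fix i assume "d < i"
  with assms show "coeff (subresultant d f g) i = 0"
    using subresultant_zero_lt[of i f g d] subresultant_zero_ge[of f g d i] by linarith
qed

lemma psc_swap: "psc d f g = (-1) ^ ((degree f - d) * (degree g - d)) * psc d g f"
proof (cases "degree f \<le> d \<and> degree g \<le> d")
  case True
  then show ?thesis by (simp add: psc_eq_1)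
next
  case False
  then show ?thesis
    using arg_cong[OF subresultant_swap[of d f g], of "\<lambda>p. coeff p d"]
    by (simp add: coeff_subresultant_eq_psc conj_commute)
qed

lemma poly_subresultant:
  fixes f g :: "'a :: idom poly"
  shows "poly (subresultant d f g) a = det (map_mat (\<lambda>p. poly p a) (subresultant_mat d f g))"
  unfolding subresultant_def
  by (rule comm_ring_hom.hom_det[OF poly_hom.comm_ring_hom_axioms, symmetric])

text \<open>
  For \<open>d = degree f\<close> there are no columns of multiples of \<open>g\<close>, so the last row consists of
  multiples of \<open>f\<close>.
\<close>

lemma poly_subresultant_eq_0:
  fixes f g :: "'a :: idom poly"
  assumes "poly f a = 0" "degree f = d" "d < degree g"
  shows "poly (subresultant d f g) a = 0"
proof -
  let ?N = "degree g - d"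
  let ?M = "map_mat (\<lambda>p. poly p a) (subresultant_mat d f g)"
  have C: "?M \<in> carrier_mat ?N ?N" using assms by auto
  have "?M $$ (?N - 1, j) = 0" if "j < ?N" for j
  proof -
    have "?N - 1 < ?N" using assms by simp
    then show ?thesis
      using that assms subresultant_index_mat[of "?N - 1" f d g j] by simp
  qed
  then have "det ?M = 0"
    using laplace_expansion_row[OF C, of "?N - 1"] assms(3) by simp
  then show ?thesis by (simp add: poly_subresultant)
qed

lemma coeff_linear_mult:
  fixes q :: "'a :: comm_ring_1 poly"
  shows "coeff_int ([:-a, 1:] * q) i = coeff_int q (i - 1) - a * coeff_int q i"
proof -
  have "[:-a, 1:] * q = pCons 0 q - smult a q" by simp
  then show ?thesis by (simp only: coeff_int_minus coeff_int_smult coeff_int_pCons_0)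
qed

lemma sum_bidiagonal:
  fixes x :: "nat \<Rightarrow> 'a :: comm_ring_1"
  assumes "j < K"
  shows "(\<Sum>k<K. x k * (if k = j then 1 else if k = Suc j \<and> Q then - a else 0))
         = x j - (if Suc j < K \<and> Q then a * x (Suc j) else 0)"
proof -
  have "x k * (if k = j then 1 else if k = Suc j \<and> Q then - a else 0)
      = (if k = j then x k else 0) - (if k = Suc j then (if Q then a * x k else 0) else 0)" for k
    by simp
  then show ?thesis using assms by (simp add: sum_subtractf)
qed

text \<open>
  These operations on columns and rows leave a determinant unchanged, because the bidiagonal
  factor has determinant 1.
\<close>

lemma mult_mat_bidiagonal_right:
  fixes A :: "'a :: comm_ring_1 mat"
  assumes "A \<in> carrier_mat K K" "i < K" "j < K"
  shows "(A * mat K K (\<lambda>(k, j). if k = j then 1 else if k = Suc j \<and> Q j then - a else 0)) $$ (i, j)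
         = A $$ (i, j) - (if Suc j < K \<and> Q j then a * A $$ (i, Suc j) else 0)"
  using assms sum_bidiagonal[of j K "\<lambda>k. A $$ (i, k)" "Q j" a]
  by (simp add: scalar_prod_def atLeast0LessThan)

lemma mult_mat_bidiagonal_left:
  fixes B :: "'a :: comm_ring_1 mat"
  assumes "B \<in> carrier_mat K K" "i < K" "j < K"
  shows "(mat K K (\<lambda>(i, k). if i = k then 1 else if i = Suc k \<and> Q i then - a else 0) * B) $$ (i, j)
         = B $$ (i, j) - (if 0 < i \<and> Q i then a * B $$ (i - 1, j) else 0)"
proof -
  let ?L = "mat K K (\<lambda>(i, k). if i = k then 1 else if i = Suc k \<and> Q i then - a else 0)"
  have "(?L * B) $$ (i, j) = (\<Sum>k<K. (if i = k then 1 else if i = Suc k \<and> Q i then - a else 0) * B $$ (k, j))"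
    using assms by (simp add: scalar_prod_def atLeast0LessThan)
  also have "\<dots> = (\<Sum>k<K. (if k = i then B $$ (k, j) else 0)
      - (if k = i - 1 then if 0 < i \<and> Q i then a * B $$ (k, j) else 0 else 0))"
    by (rule sum.cong) auto
  also have "\<dots> = B $$ (i, j) - (if 0 < i \<and> Q i then a * B $$ (i - 1, j) else 0)"
    using assms(2) by (auto simp: sum_subtractf)
  finally show ?thesis .
qed

text \<open>
  Write \<open>F = (x - a) f\<close>. The columns of the subresultant matrix stand for the polynomials
  \<open>x\<^sup>i F\<close> and \<open>x\<^sup>j g\<close>; its rows are the coefficients of these polynomials above \<open>x\<^sup>d\<close>, and, after
  evaluation, their value at \<open>a\<close>. Replacing \<open>x\<^sup>j g\<close> by \<open>(x - a) x\<^bsup>j-1\<^esup> g\<close> for \<open>j > 0\<close> makes every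
  column except the last one (that of \<open>g\<close>) the column of a multiple of \<open>x - a\<close>, with value 0 at
  \<open>a\<close>. The coefficients of \<open>(x - a) q\<close> are differences of those of \<open>q\<close>, so an invertible
  bidiagonal row operation replaces the columns by those of the quotients \<open>x\<^sup>i f\<close> and \<open>x\<^sup>j g\<close>, whose
  coefficients from \<open>x\<^sup>d\<close> on form the matrix of \<open>psc d f g\<close>. The value \<open>g(a)\<close> remains in the lower
  right corner.
\<close>

lemma poly_subresultant_at_root:
  fixes f g :: "'a :: idom poly"
  assumes f0: "f \<noteq> 0" and d: "d \<le> degree f" "d \<le> degree g"
  shows "poly (subresultant d ([:-a, 1:] * f) g) a = poly g a * psc d f g"
proof -
  define F where "F = [:-a, 1:] * f"
  define m n where "m = degree f - d" and "n = degree g - d"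
  have degF: "degree F = Suc (degree f)" unfolding F_def
    by (subst degree_mult_eq) (use f0 in auto)
  have m: "degree F - d = Suc m" using d degF by (simp add: m_def)
  let ?N = "m + n"
  let ?M = "map_mat (\<lambda>p. poly p a) (subresultant_mat d F g)"
  define h where "h = synthetic_div g a"
  have g: "g = [:-a, 1:] * h + [:poly g a:]"
    using synthetic_div_correct'[of a g] by (simp add: h_def)
  define P where "P = subresultant'_mat d d f g"
  \<comment> \<open>The last column: the quotient of g - g(a) by x - a.\<close>
  define V where "V = mat ?N 1 (\<lambda>(i, j). coeff_int h (int (degree g) - 1 - int i + int m))"
  define B where "B = four_block_mat P V (0\<^sub>m 1 ?N) (mat 1 1 (\<lambda>_. poly g a))"
  \<comment> \<open>C performs the column operations on the multiples of \<open>g\<close>, L multiplies by x - a.\<close>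
  define L where "L = mat (Suc ?N) (Suc ?N) (\<lambda>(i, j). if i = j then 1
     else if i = Suc j \<and> i < ?N then -a else 0)"
  define C where "C = mat (Suc ?N) (Suc ?N) (\<lambda>(i, j). if i = j then 1
     else if i = Suc j \<and> n \<le> j then -a else 0)"
  have Mc: "?M \<in> carrier_mat (Suc ?N) (Suc ?N)" using m n_def by auto
  have Pc: "P \<in> carrier_mat ?N ?N" by (simp add: P_def subresultant'_mat_def m_def n_def Let_def)
  have Bc: "B \<in> carrier_mat (Suc ?N) (Suc ?N)" unfolding B_def
    using four_block_carrier_mat[OF Pc, of "mat 1 1 (\<lambda>_. poly g a)" 1 1] by simp
  have M_index: "?M $$ (i, j) =
      (if j < n then if i = ?N then 0 else coeff_int F (int (degree F) - int i + int j)
       else if i = ?N then a ^ (m - (j - n)) * poly g a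
       else coeff_int g (int (degree g) - int i + int (j - n)))"
    if "i < Suc ?N" "j < Suc ?N" for i j
    using that subresultant_index_mat[of i F d g j] m
    by (auto simp: n_def F_def poly_monom Let_def)
  have P_index: "P $$ (i, j) =
      (if j < n then coeff_int f (int (degree f) - int i + int j)
       else coeff_int g (int (degree g) - int i + int (j - n)))" if "i < ?N" "j < ?N" for i j
    using that d unfolding P_def subresultant'_mat_def Let_def
    by (auto simp: m_def n_def intro!: arg_cong[of _ _ "coeff_int _"])
  have MC: "(?M * C) $$ (i, j) = ?M $$ (i, j) - (if Suc j < Suc ?N \<and> n \<le> j then a * ?M $$ (i, Suc j) else 0)"
    if "i < Suc ?N" "j < Suc ?N" for i j
    unfolding C_def by (rule mult_mat_bidiagonal_right[OF Mc that])
  have LB: "(L * B) $$ (i, j) = B $$ (i, j) - (if 0 < i \<and> i < ?N then a * B $$ (i - 1, j) else 0)"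
    if "i < Suc ?N" "j < Suc ?N" for i j
    unfolding L_def by (rule mult_mat_bidiagonal_left[OF Bc that])
  have B_index: "B $$ (i, j) = (if j < ?N then if i < ?N then P $$ (i, j) else 0
      else if i < ?N then coeff_int h (int (degree g) - 1 - int i + int m) else poly g a)"
    if "i < Suc ?N" "j < Suc ?N" for i j
    using that Pc by (auto simp: B_def V_def)
  have F_coeff: "coeff_int F k = coeff_int f (k - 1) - a * coeff_int f k" for k
    unfolding F_def by (rule coeff_linear_mult)
  have g_coeff: "coeff_int g k = coeff_int h (k - 1) - a * coeff_int h k" if "0 < k" for k
  proof -
    have "[:-a, 1:] * h = g - [:poly g a:]"
      using g[symmetric] by (simp only: eq_diff_eq)
    then have "coeff_int ([:-a, 1:] * h) k = coeff_int g k - coeff_int [:poly g a:] k"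
      by (simp only: coeff_int_minus)
    moreover have "coeff_int [:poly g a:] k = 0" using that by (intro coeff_int_eq_0) simp
    ultimately show ?thesis by (simp only: coeff_linear_mult diff_zero)
  qed
  have "?M * C = L * B"
  proof (rule eq_matI)
    fix i j assume "i < dim_row (L * B)" "j < dim_col (L * B)"
    then have ij: "i < Suc ?N" "j < Suc ?N" using Bc by (auto simp: L_def)
    consider "j < n" "i < ?N" | "n \<le> j" "j < ?N" "i < ?N" | "j = ?N" "i < ?N" | "i = ?N"
      using ij by linarith
    then show "(?M * C) $$ (i, j) = (L * B) $$ (i, j)"
    proof cases
      case 1
      then show ?thesis
        using ij by (cases "i = 0")
          (auto simp: MC LB M_index B_index P_index F_coeff degF coeff_int_eq_0 of_nat_diff algebra_simps)
    next
      case 2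
      then show ?thesis
        using ij by (cases "i = 0")
          (auto simp: MC LB M_index B_index P_index coeff_int_eq_0 of_nat_diff algebra_simps)
    next
      case 3
      have "coeff_int h (int (degree g) + int m) = 0"
        using 3 by (intro coeff_int_eq_0) (auto simp: h_def degree_synthetic_div n_def)
      then show ?thesis
        using 3 ij d g_coeff[of "int (degree g) - int i + int m"]
        by (cases "i = 0") (auto simp: MC LB M_index B_index m_def n_def of_nat_diff algebra_simps)
    next
      case 4
      then show ?thesis
        using ij by (auto simp: MC LB M_index B_index Suc_diff_le[symmetric] simp flip: power_Suc)
    qed
  qed (use Mc Bc in \<open>auto simp: L_def C_def\<close>)
  moreover have "det C = 1"
    by (subst det_lower_triangular[of "Suc ?N"])
      (auto simp: C_def prod_list_diag_prod)
  moreover have "det L = 1"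
    by (subst det_lower_triangular[of "Suc ?N"])
      (auto simp: L_def prod_list_diag_prod)
  moreover have "det B = det P * poly g a"
    unfolding B_def
    by (subst det_four_block_mat_lower_left_zero[OF Pc]) (auto simp: V_def det_single)
  ultimately have "det ?M = poly g a * det P"
    using det_mult[OF Mc, of C] det_mult[OF _ Bc, of L] by (simp add: C_def L_def mult.commute)
  then show ?thesis by (simp add: poly_subresultant F_def P_def psc_def)
qed

section \<open>Values of the Sylvester sum at roots\<close>

text \<open>
  The Sylvester sum for \<open>f = f0 * root_poly X\<close> and \<open>g = g0 * root_poly Y\<close>. The cofactors \<open>f0\<close> and
  \<open>g0\<close> are given as polynomials rather than by their roots, which makes it easy to change the field. For
  \<open>f0 = \<Prod>(x - a)\<close> over a multiset \<open>M\<close>, the factor \<open>(-1) ^ degree f0 * poly f0 b\<close> is \<open>\<R>(M, {b})\<close>.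
\<close>

definition sylv_coeff :: "'a :: field poly \<Rightarrow> 'a poly \<Rightarrow> 'a set \<Rightarrow> 'a set \<Rightarrow> 'a set \<Rightarrow> 'a set \<Rightarrow> 'a" where
  "sylv_coeff f0 g0 X Y S T =
     (\<Prod>a\<in>X - S. poly g0 a) * (\<Prod>b\<in>Y - T. (-1) ^ degree f0 * poly f0 b) * diff_prod (X - S) (Y - T)
     / (diff_prod S (X - S) * diff_prod T (Y - T))"

definition sylv_poly :: "nat \<Rightarrow> 'a :: field poly \<Rightarrow> 'a poly \<Rightarrow> 'a set \<Rightarrow> 'a set \<Rightarrow> 'a poly" where
  "sylv_poly d f0 g0 X Y = (\<Sum>S\<in>ksubsets X (d - degree f0). \<Sum>T\<in>ksubsets Y (degree f0).
     smult (sylv_coeff f0 g0 X Y S T) (root_poly S * root_poly T))"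

definition sylv_lead :: "nat \<Rightarrow> 'a :: field poly \<Rightarrow> 'a poly \<Rightarrow> 'a set \<Rightarrow> 'a set \<Rightarrow> 'a" where
  "sylv_lead d f0 g0 X Y = (\<Sum>S\<in>ksubsets X (d - degree f0). \<Sum>T\<in>ksubsets Y (degree f0).
     sylv_coeff f0 g0 X Y S T)"

lemma
  assumes "degree f0 \<le> d"
  shows degree_sylv_poly_le: "degree (sylv_poly d f0 g0 X Y) \<le> d"
    and coeff_sylv_poly: "coeff (sylv_poly d f0 g0 X Y) d = sylv_lead d f0 g0 X Y"
proof -
  have deg: "degree (root_poly S * root_poly T :: 'a poly) = d"
    if "card S = d - degree f0" "card T = degree f0" for S T
    using that assms by (subst degree_mult_eq) (auto simp: degree_root_poly)
  show "degree (sylv_poly d f0 g0 X Y) \<le> d"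
  proof (rule degree_le, intro allI impI)
    fix i assume "d < i"
    then show "coeff (sylv_poly d f0 g0 X Y) i = 0"
      unfolding sylv_poly_def coeff_sum coeff_smult
      by (intro sum.neutral ballI) (auto intro!: coeff_eq_0 simp: deg)
  qed
  have "coeff (root_poly S * root_poly T :: 'a poly) d = 1"
    if "card S = d - degree f0" "card T = degree f0" for S T
    using deg[OF that] root_poly_monic[of S] root_poly_monic[of T]
    by (metis lead_coeff_mult mult_1)
  then show "coeff (sylv_poly d f0 g0 X Y) d = sylv_lead d f0 g0 X Y"
    unfolding sylv_poly_def sylv_lead_def coeff_sum coeff_smult
    by (intro sum.cong refl) auto
qed

lemma minus_one_power_square: "(-1) ^ k * (-1) ^ k = (1 :: 'a :: comm_ring_1)"
  by (simp flip: power_mult_distrib)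

text \<open>
  The cancellation common to \<open>poly_sylv_poly_left\<close> and \<open>poly_sylv_poly_right\<close>: \<open>s\<close> is the
  value of \<open>root_poly S\<close> at the point and \<open>e\<close> the sign that comes with it in the denominator.
\<close>

lemma cancel_sign_and_root:
  fixes e :: "'a :: field"
  assumes "e * e = 1" "s \<noteq> 0"
  shows "(u * U) * V * (r * D) / ((e * s * D1) * D2) * (s * t) = e * (u * (r * t)) * (U * V * D / (D1 * D2))"
proof -
  consider "e = 1" | "e = -1" using assms(1) by (auto simp: square_eq_1_iff)
  then show ?thesis using assms(2) by cases (simp_all add: mult_ac)
qed

lemma poly_root_poly_eq_0: "finite S \<Longrightarrow> a \<in> S \<Longrightarrow> poly (root_poly S) a = 0"
  unfolding poly_root_poly by (rule prod_zero) auto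

lemma poly_root_poly_diff:
  assumes "finite Y" "T \<subseteq> Y"
  shows "poly (root_poly (Y - T)) a * poly (root_poly T) a = poly (root_poly Y) a"
  unfolding poly_root_poly by (rule prod.subset_diff[OF assms(2,1), symmetric])

text \<open>
  Only the subsets \<open>S\<close> that avoid \<open>a\<close> survive. In their terms, \<open>g0(a)\<close> and the factors \<open>a - b\<close> for
  \<open>b \<in> Y - T\<close> and \<open>b \<in> T\<close> combine to \<open>g(a)\<close>, and the factors \<open>s - a\<close> of the denominator cancel the
  value of \<open>root_poly S\<close> up to sign. What remains is the coefficient for \<open>X\<close> without \<open>a\<close>.
\<close>

lemma poly_sylv_poly_left:
  assumes "finite X" "finite Y" "a \<notin> X"
  shows "poly (sylv_poly d f0 g0 (insert a X) Y) a
         = (-1) ^ (d - degree f0) * poly (g0 * root_poly Y) a * sylv_lead d f0 g0 X Y"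
proof -
  let ?c = "sylv_coeff f0 g0"
  have "poly (sylv_poly d f0 g0 (insert a X) Y) a =
      (\<Sum>S\<in>ksubsets (insert a X) (d - degree f0). \<Sum>T\<in>ksubsets Y (degree f0).
         ?c (insert a X) Y S T * (poly (root_poly S) a * poly (root_poly T) a))"
    by (simp add: sylv_poly_def poly_sum)
  also have "\<dots> = (\<Sum>S\<in>ksubsets X (d - degree f0). \<Sum>T\<in>ksubsets Y (degree f0).
         ?c (insert a X) Y S T * (poly (root_poly S) a * poly (root_poly T) a))"
    by (rule sum_ksubsets_insert[OF assms(1)]) (simp add: poly_root_poly_eq_0)
  also have "\<dots> = (\<Sum>S\<in>ksubsets X (d - degree f0). \<Sum>T\<in>ksubsets Y (degree f0).
         (-1) ^ (d - degree f0) * poly (g0 * root_poly Y) a * ?c X Y S T)"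
  proof (intro sum.cong refl)
    fix S T assume S: "S \<in> ksubsets X (d - degree f0)" and T: "T \<in> ksubsets Y (degree f0)"
    have S': "finite S" "a \<notin> S" "a \<notin> X - S" "insert a X - S = insert a (X - S)"
      using S assms finite_subset by auto
    have nz: "poly (root_poly S) a \<noteq> 0" using S' by (auto simp: poly_root_poly)
    have "?c (insert a X) Y S T =
        (poly g0 a * (\<Prod>a\<in>X - S. poly g0 a)) * (\<Prod>b\<in>Y - T. (-1) ^ degree f0 * poly f0 b)
        * (poly (root_poly (Y - T)) a * diff_prod (X - S) (Y - T))
        / (((-1) ^ (d - degree f0) * poly (root_poly S) a * diff_prod S (X - S)) * diff_prod T (Y - T))"
      using S S' assms(1) by (simp add: sylv_coeff_def diff_prod_insert_left diff_prod_insert_right)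
    then have "?c (insert a X) Y S T * (poly (root_poly S) a * poly (root_poly T) a)
        = (-1) ^ (d - degree f0) * (poly g0 a * (poly (root_poly (Y - T)) a * poly (root_poly T) a)) * ?c X Y S T"
      unfolding sylv_coeff_def
      by (simp only: cancel_sign_and_root[OF _ nz] minus_one_power_square)
    also have "poly (root_poly (Y - T)) a * poly (root_poly T) a = poly (root_poly Y) a"
      using T assms(2) by (intro poly_root_poly_diff) auto
    finally show "?c (insert a X) Y S T * (poly (root_poly S) a * poly (root_poly T) a)
        = (-1) ^ (d - degree f0) * poly (g0 * root_poly Y) a * ?c X Y S T" by simp
  qed
  finally show ?thesis by (simp add: sylv_lead_def sum_distrib_left)
qed

text \<open>
  The analogue for a root of \<open>g\<close>. Here the sign that comes with \<open>f0(b)\<close> cancels against the one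
  from the denominator, and the sign of the \<open>card (X - S)\<close> factors \<open>a - b\<close> survives.
\<close>

lemma poly_sylv_poly_right:
  assumes "finite X" "finite Y" "b \<notin> Y" "degree f0 \<le> d" "d \<le> degree f0 + card X"
  shows "poly (sylv_poly d f0 g0 X (insert b Y)) b
         = (-1) ^ (degree f0 + card X - d) * poly (f0 * root_poly X) b * sylv_lead d f0 g0 X Y"
proof -
  let ?c = "sylv_coeff f0 g0"
  have "poly (sylv_poly d f0 g0 X (insert b Y)) b =
      (\<Sum>S\<in>ksubsets X (d - degree f0). \<Sum>T\<in>ksubsets (insert b Y) (degree f0).
         ?c X (insert b Y) S T * (poly (root_poly S) b * poly (root_poly T) b))"
    by (simp add: sylv_poly_def poly_sum)
  also have "\<dots> = (\<Sum>S\<in>ksubsets X (d - degree f0). \<Sum>T\<in>ksubsets Y (degree f0).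
         ?c X (insert b Y) S T * (poly (root_poly S) b * poly (root_poly T) b))"
    by (rule sum.cong[OF refl], rule sum_ksubsets_insert[OF assms(2)]) (simp add: poly_root_poly_eq_0)
  also have "\<dots> = (\<Sum>S\<in>ksubsets X (d - degree f0). \<Sum>T\<in>ksubsets Y (degree f0).
         (-1) ^ (degree f0 + card X - d) * poly (f0 * root_poly X) b * ?c X Y S T)"
  proof (intro sum.cong refl)
    fix S T assume S: "S \<in> ksubsets X (d - degree f0)" and T: "T \<in> ksubsets Y (degree f0)"
    have T': "finite T" "b \<notin> T" "b \<notin> Y - T" "insert b Y - T = insert b (Y - T)"
      using T assms finite_subset by auto
    have S': "card (X - S) = degree f0 + card X - d"
      using S assms by (subst card_Diff_subset) (auto intro: finite_subset)
    have nz: "poly (root_poly T) b \<noteq> 0" using T' by (auto simp: poly_root_poly)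
    have "?c X (insert b Y) S T =
        (((-1) ^ degree f0 * poly f0 b) * (\<Prod>b\<in>Y - T. (-1) ^ degree f0 * poly f0 b)) * (\<Prod>a\<in>X - S. poly g0 a)
        * (((-1) ^ (degree f0 + card X - d) * poly (root_poly (X - S)) b) * diff_prod (X - S) (Y - T))
        / (((-1) ^ degree f0 * poly (root_poly T) b * diff_prod T (Y - T)) * diff_prod S (X - S))"
      using T T' S' assms(2) by (simp add: sylv_coeff_def diff_prod_insert_right mult_ac)
    then have "?c X (insert b Y) S T * (poly (root_poly T) b * poly (root_poly S) b)
        = (-1) ^ degree f0 * ((-1) ^ degree f0 * poly f0 b
            * ((-1) ^ (degree f0 + card X - d) * poly (root_poly (X - S)) b * poly (root_poly S) b))
          * ((\<Prod>b\<in>Y - T. (-1) ^ degree f0 * poly f0 b) * (\<Prod>a\<in>X - S. poly g0 a)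
             * diff_prod (X - S) (Y - T) / (diff_prod T (Y - T) * diff_prod S (X - S)))"
      by (simp only: cancel_sign_and_root[OF _ nz] minus_one_power_square)
    also have "\<dots> = ((-1) ^ degree f0 * (-1) ^ degree f0) * ((-1) ^ (degree f0 + card X - d)
          * (poly f0 b * (poly (root_poly (X - S)) b * poly (root_poly S) b)) * ?c X Y S T)"
      unfolding sylv_coeff_def by (simp only: mult_ac)
    finally have "?c X (insert b Y) S T * (poly (root_poly S) b * poly (root_poly T) b)
        = (-1) ^ (degree f0 + card X - d) * (poly f0 b * (poly (root_poly (X - S)) b * poly (root_poly S) b))
          * ?c X Y S T"
      by (simp only: minus_one_power_square mult_1 mult.commute[of "poly (root_poly S) b"])
    also have "poly (root_poly (X - S)) b * poly (root_poly S) b = poly (root_poly X) b"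
      using S assms by (intro poly_root_poly_diff) auto
    finally show "?c X (insert b Y) S T * (poly (root_poly S) b * poly (root_poly T) b)
        = (-1) ^ (degree f0 + card X - d) * poly (f0 * root_poly X) b * ?c X Y S T" by simp
  qed
  finally show ?thesis by (simp add: sylv_lead_def sum_distrib_left)
qed

lemma ksubsets_card: "finite X \<Longrightarrow> ksubsets X (card X) = {X}"
  using card_subset_eq by blast

text \<open>
  For \<open>degree f = d\<close> only \<open>S = X\<close> has the right size, and a Lagrange sum over \<open>Y\<close> remains.
\<close>

lemma sylv_lead_eq_1:
  assumes "finite X" "finite Y" "degree f0 + card X = d" "degree f0 \<le> card Y" "lead_coeff f0 = 1"
  shows "sylv_lead d f0 g0 X Y = 1"
proof -
  have "ksubsets X (d - degree f0) = {X}"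
    using assms(3) ksubsets_card[OF assms(1)] by force
  then have "sylv_lead d f0 g0 X Y = (\<Sum>T\<in>ksubsets Y (degree f0).
      (\<Prod>b\<in>Y - T. poly (smult ((-1) ^ degree f0) f0) b) / diff_prod T (Y - T))"
    by (simp add: sylv_lead_def sylv_coeff_def)
  also have "\<dots> = ((-1) ^ degree f0 * coeff (smult ((-1) ^ degree f0) f0) (degree f0)) ^ (card Y - degree f0)"
    by (rule lagrange_sum[OF assms(2,4) degree_smult_le])
  also have "\<dots> = 1"
    by (simp only: coeff_smult assms(5) mult_1_right minus_one_power_square power_one)
  finally show ?thesis .
qed

text \<open>
  For fixed \<open>T\<close>, the sum over \<open>S\<close> is a Lagrange sum for \<open>z = g0 * root_poly (Y - T)\<close>, whose degree is
  too small.
\<close>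

lemma sylv_lead_eq_0:
  assumes "finite X" "finite Y" "g0 \<noteq> 0" "degree g0 + card Y < d" "degree f0 \<le> d" "d < degree f0 + card X"
  shows "sylv_lead d f0 g0 X Y = 0"
proof -
  let ?p = "degree f0"
  have "(\<Sum>S\<in>ksubsets X (d - ?p). sylv_coeff f0 g0 X Y S T) = 0" if T: "T \<in> ksubsets Y ?p" for T
  proof -
    let ?z = "g0 * root_poly (Y - T)"
    have "degree ?z = degree g0 + (card Y - ?p)"
      using T assms(3) finite_subset[OF _ assms(2), of T]
      by (simp add: degree_mult_eq degree_root_poly card_Diff_subset)
    moreover have "?p \<le> card Y" using T card_mono[OF assms(2), of T] by simp
    ultimately have deg: "degree ?z < d - ?p" using assms(4) by linarith
    have "(\<Sum>S\<in>ksubsets X (d - ?p). sylv_coeff f0 g0 X Y S T)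
        = (\<Prod>b\<in>Y - T. (-1) ^ ?p * poly f0 b) / diff_prod T (Y - T) *
          (\<Sum>S\<in>ksubsets X (d - ?p). (\<Prod>a\<in>X - S. poly ?z a) / diff_prod S (X - S))"
      unfolding sum_distrib_left
      by (rule sum.cong[OF refl]) (simp add: sylv_coeff_def prod.distrib diff_prod_def poly_root_poly mult_ac)
    also have "(\<Sum>S\<in>ksubsets X (d - ?p). (\<Prod>a\<in>X - S. poly ?z a) / diff_prod S (X - S)) = 0"
      using assms deg by (subst lagrange_sum) (auto simp: coeff_eq_0)
    finally show ?thesis by simp
  qed
  then show ?thesis
    unfolding sylv_lead_def by (subst sum.swap) (rule sum.neutral, blast)
qed

section \<open>Comparison at the chosen roots\<close>

lemma degree_mult_root_poly:
  fixes f0 :: "'a :: idom poly"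
  assumes "lead_coeff f0 = 1"
  shows "degree (f0 * root_poly X) = degree f0 + card X"
  using assms by (subst degree_mult_eq) (auto simp: degree_root_poly)

text \<open>
  Both sides have degree at most \<open>d\<close>, and \<open>X \<union> Y\<close> has at least \<open>degree f + degree g - d\<close> elements
  because \<open>degree f0 + degree g0 \<le> d\<close>; this exceeds \<open>d\<close> unless both degrees are \<open>d\<close>. At each of these
  points both sides are the same multiple of the principal coefficient of the problem with that root
  removed. The principal coefficients are therefore part of the induction; in the exceptional case
  both are 1.
\<close>

lemma subresultant_eq_sylv_poly_disjoint:
  fixes f0 g0 :: "'a :: field poly"
  assumes monic: "lead_coeff f0 = 1" "lead_coeff g0 = 1"
    and fin: "finite X" "finite Y" "X \<inter> Y = {}"
    and d: "degree f0 + degree g0 \<le> d" "d \<le> degree f0 + card X" "d \<le> degree g0 + card Y"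
  shows "psc d (f0 * root_poly X) (g0 * root_poly Y)
           = (-1) ^ ((d - degree f0) * (degree f0 + card X - d)) * sylv_lead d f0 g0 X Y \<and>
         (\<not> (degree f0 + card X = d \<and> degree g0 + card Y = d) \<longrightarrow>
          subresultant d (f0 * root_poly X) (g0 * root_poly Y)
           = smult ((-1) ^ ((d - degree f0) * (degree f0 + card X - d))) (sylv_poly d f0 g0 X Y))"
  using fin d
proof (induction "card X + card Y" arbitrary: X Y rule: less_induct)
  case less
  note fin = less.prems(1,2) and disj = less.prems(3) and d = less.prems(4-6)
  define m n q where "m = degree f0 + card X" and "n = degree g0 + card Y" and "q = d - degree f0"
  define f g where "f = f0 * root_poly X" and "g = g0 * root_poly Y"
  have deg: "degree f = m" "degree g = n"
    by (simp_all add: f_def g_def m_def n_def degree_mult_root_poly monic)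
  have dle: "d \<le> m" "d \<le> n" using d by (simp_all add: m_def n_def)
  have nz: "f0 \<noteq> 0" "g0 \<noteq> 0" using monic by auto
  show ?case
  proof (cases "m = d \<and> n = d")
    case True
    then have "sylv_lead d f0 g0 X Y = 1"
      using fin d monic by (intro sylv_lead_eq_1) (auto simp: m_def n_def)
    moreover have "psc d f g = 1" using True deg by (intro psc_eq_1) auto
    ultimately show ?thesis using True by (simp add: m_def n_def f_def g_def)
  next
    case False
    have "subresultant d f g = smult ((-1) ^ (q * (m - d))) (sylv_poly d f0 g0 X Y)"
    proof (rule poly_eqI_card)
      have card: "d < card (X \<union> Y)"
        using False d disj fin by (subst card_Un_disjoint) (auto simp: m_def n_def)
      have "degree (subresultant d f g) \<le> d"
        by (rule degree_subresultant_le) (use False dle in \<open>simp_all add: deg\<close>)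
      then show "degree (subresultant d f g) < card (X \<union> Y)" using card by simp
      show "degree (smult ((-1) ^ (q * (m - d))) (sylv_poly d f0 g0 X Y)) < card (X \<union> Y)"
        by (rule le_less_trans[OF degree_smult_le le_less_trans[OF degree_sylv_poly_le card]])
          (use d in simp)
    next
      fix x assume "x \<in> X \<union> Y"
      then consider "x \<in> X" | "x \<in> Y" by blast
      then show "poly (subresultant d f g) x = poly (smult ((-1) ^ (q * (m - d))) (sylv_poly d f0 g0 X Y)) x"
      proof cases
        case 1
        define Z where "Z = X - {x}"
        have Z: "X = insert x Z" "x \<notin> Z" "finite Z" "card X = Suc (card Z)"
          using 1 fin card_Suc_Diff1[of X x] by (auto simp: Z_def)
        have f: "f = [:- x, 1:] * (f0 * root_poly Z)"
          unfolding f_def Z(1) root_poly_insert[OF Z(3,2)] by (simp only: mult_ac)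
        have sylv: "poly (sylv_poly d f0 g0 X Y) x = (-1) ^ q * poly g x * sylv_lead d f0 g0 Z Y"
          unfolding Z(1) q_def g_def by (rule poly_sylv_poly_left[OF Z(3) fin(2) Z(2)])
        \<comment> \<open>For m = d the reduced problem lies outside the induction; both sides vanish at x.\<close>
        show ?thesis
        proof (cases "m = d")
          case True
          have "card S \<noteq> d - degree f0" if "S \<subseteq> Z" for S
            using card_mono[OF Z(3) that] True Z(4) by (simp add: m_def)
          then have "ksubsets Z (d - degree f0) = {}" by blast
          then have "sylv_lead d f0 g0 Z Y = 0" by (simp only: sylv_lead_def sum.empty)
          moreover have "poly (subresultant d f g) x = 0"
            by (rule poly_subresultant_eq_0) (simp add: f, use True False dle deg in simp_all)
          ultimately show ?thesis by (simp add: sylv)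
        next
          case neq: False
          then have lt: "d < m" "m - d = Suc (degree f0 + card Z - d)" "d \<le> degree f0 + card Z"
            using dle Z(4) by (simp_all add: m_def)
          have "poly (subresultant d f g) x = poly g x * psc d (f0 * root_poly Z) g"
            unfolding f using nz lt dle
            by (intro poly_subresultant_at_root) (simp_all add: degree_mult_root_poly monic deg)
          also have "psc d (f0 * root_poly Z) g
              = (-1) ^ (q * (degree f0 + card Z - d)) * sylv_lead d f0 g0 Z Y"
            unfolding g_def q_def using Z disj fin d lt
            by (intro less.hyps[of Z Y, THEN conjunct1]) auto
          also have "(-1) ^ (q * (degree f0 + card Z - d)) = (-1) ^ (q * (m - d)) * ((-1) ^ q :: 'a)"
            unfolding lt(2) by (simp add: minus_one_power_iff)
          finally show ?thesis by (simp add: sylv)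
        qed
      next
        case 2
        define Z where "Z = Y - {x}"
        have Z: "Y = insert x Z" "x \<notin> Z" "finite Z" "card Y = Suc (card Z)"
          using 2 fin card_Suc_Diff1[of Y x] by (auto simp: Z_def)
        have g: "g = [:- x, 1:] * (g0 * root_poly Z)"
          unfolding g_def Z(1) root_poly_insert[OF Z(3,2)] by (simp only: mult_ac)
        have sylv: "poly (sylv_poly d f0 g0 X Y) x = (-1) ^ (m - d) * poly f x * sylv_lead d f0 g0 X Z"
          unfolding Z(1) m_def f_def
          using Z fin d by (intro poly_sylv_poly_right) auto
        have swap: "poly (subresultant d f g) x
            = (-1) ^ ((m - d) * (n - d)) * poly (subresultant d g f) x"
          by (simp add: subresultant_swap[of d f g] deg)
        \<comment> \<open>For n = d the sum for the reduced problem vanishes for degree reasons.\<close>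
        show ?thesis
        proof (cases "n = d")
          case True
          have "sylv_lead d f0 g0 X Z = 0"
            using True False dle d Z fin nz by (intro sylv_lead_eq_0) (auto simp: m_def n_def)
          moreover have "poly (subresultant d g f) x = 0"
            by (rule poly_subresultant_eq_0) (simp add: g, use True False dle deg in simp_all)
          ultimately show ?thesis by (simp add: sylv swap)
        next
          case neq: False
          then have lt: "d < n" "n - d = Suc (degree g0 + card Z - d)" "d \<le> degree g0 + card Z"
            using dle Z(4) by (simp_all add: n_def)
          have degZ: "degree (g0 * root_poly Z) = degree g0 + card Z"
            by (simp add: degree_mult_root_poly monic)
          have "poly (subresultant d g f) x = poly f x * psc d (g0 * root_poly Z) f"
            unfolding g using nz lt dle
            by (intro poly_subresultant_at_root) (simp_all add: degZ deg)
          also have "psc d (g0 * root_poly Z) f = (-1) ^ ((degree g0 + card Z - d) * (m - d)) * psc d f (g0 * root_poly Z)"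
            by (subst psc_swap) (simp add: degZ deg)
          also have "psc d f (g0 * root_poly Z) = (-1) ^ (q * (m - d)) * sylv_lead d f0 g0 X Z"
            unfolding f_def q_def m_def using Z disj fin d lt
            by (intro less.hyps[of X Z, THEN conjunct1]) auto
          finally have "poly (subresultant d f g) x
              = ((-1) ^ ((m - d) * (n - d)) * (-1) ^ ((degree g0 + card Z - d) * (m - d)))
                * (poly f x * ((-1) ^ (q * (m - d)) * sylv_lead d f0 g0 X Z))"
            by (simp add: swap)
          also have "(-1) ^ ((m - d) * (n - d)) * (-1) ^ ((degree g0 + card Z - d) * (m - d)) = ((-1) ^ (m - d) :: 'a)"
            unfolding lt(2) by (simp add: minus_one_power_iff)
          finally show ?thesis by (simp add: sylv)
        qed
      qed
    qed
    note sub = this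
    have "psc d f g = coeff (subresultant d f g) d"
      by (rule coeff_subresultant_eq_psc[symmetric]) (use False dle in \<open>simp add: deg\<close>)
    also have "\<dots> = (-1) ^ (q * (m - d)) * sylv_lead d f0 g0 X Y"
      using d by (simp add: sub coeff_sylv_poly)
    finally show ?thesis using sub by (simp only: f_def g_def q_def m_def) blast
  qed
qed

section \<open>Removing disjointness by deformation\<close>

text \<open>
  The size of the matrix depends on the degrees, which a homomorphism such as the evaluation of a
  parameter may lower.
\<close>

lemma (in comm_ring_hom) map_poly_subresultant:
  assumes "degree (map_poly hom f) = degree f" "degree (map_poly hom g) = degree g"
  shows "map_poly hom (subresultant d f g) = subresultant d (map_poly hom f) (map_poly hom g)"
proof -
  interpret p: map_poly_comm_ring_hom hom ..
  have "map_mat (map_poly hom) (subresultant_mat d f g) = subresultant_mat d (map_poly hom f) (map_poly hom g)"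
    by (rule eq_matI)
      (auto simp: subresultant_mat_def Let_def assms coeff_int_def hom_distribs)
  then show ?thesis unfolding subresultant_def by (simp flip: p.hom_det)
qed

lemma sum_ksubsets_image:
  assumes "inj h"
  shows "(\<Sum>S\<in>ksubsets (h ` X) k. F S) = (\<Sum>S\<in>ksubsets X k. F (h ` S))"
proof -
  have "ksubsets (h ` X) k = (`) h ` ksubsets X k"
    using assms by (auto simp: subset_image_iff card_image inj_on_subset)
  moreover have "inj_on ((`) h) (ksubsets X k)"
    using assms by (auto simp: inj_on_def inj_image_eq_iff)
  ultimately show ?thesis by (simp add: sum.reindex)
qed

text \<open>
  A common element of \<open>X\<close> and \<open>Y\<close> counts only once as an interpolation point, so disjointness is
  obtained by deformation. Each \<open>a \<in> X\<close> is replaced by \<open>a + t\<close> with an indeterminate \<open>t\<close>; the rest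
  of the data stays. In the fraction field of \<open>K[t]\<close>, the elements \<open>a + t\<close> differ from the constants
  in \<open>Y\<close>, so the identity for disjoint sets applies. Its denominators involve only differences within
  \<open>X\<close> and within \<open>Y\<close>, which do not contain \<open>t\<close>. Hence it is an identity of polynomials over \<open>K[t]\<close>, and
  \<open>t = 0\<close> can be substituted.
\<close>

lemma subresultant_eq_sylv_poly:
  fixes f0 g0 :: "'a :: field poly"
  assumes monic: "lead_coeff f0 = 1" "lead_coeff g0 = 1"
    and fin: "finite X" "finite Y"
    and d: "degree f0 + degree g0 \<le> d" "d \<le> degree f0 + card X" "d \<le> degree g0 + card Y"
      "\<not> (degree f0 + card X = d \<and> degree g0 + card Y = d)"
  shows "subresultant d (f0 * root_poly X) (g0 * root_poly Y)
         = smult ((-1) ^ ((d - degree f0) * (degree f0 + card X - d))) (sylv_poly d f0 g0 X Y)"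
proof -
  \<comment> \<open>c embeds constants, t gives the deformed roots, e sets the parameter to 0.\<close>
  define c :: "'a \<Rightarrow> 'a poly" where "c = (\<lambda>a. [:a:])"
  define t :: "'a \<Rightarrow> 'a poly" where "t = (\<lambda>a. [:a, 1:])"
  define h :: "'a poly \<Rightarrow> 'a poly fract" where "h = to_fract"
  define e :: "'a poly \<Rightarrow> 'a" where "e = (\<lambda>p. poly p 0)"
  interpret c: inj_comm_ring_hom c unfolding c_def by (rule coeff_lift_hom.inj_comm_ring_hom_axioms)
  interpret h: inj_comm_ring_hom h unfolding h_def by (rule to_fract_hom.inj_comm_ring_hom_axioms)
  interpret e: comm_ring_hom e unfolding e_def by (rule poly_hom.comm_ring_hom_axioms)
  interpret pc: map_poly_inj_comm_ring_hom c ..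
  interpret ph: map_poly_inj_comm_ring_hom h ..
  interpret pe: map_poly_comm_ring_hom e ..
  have ect: "e (c a) = a" "e (t a) = a" for a by (simp_all add: e_def c_def t_def)
  have tdiff: "t a - t b = c (a - b)" for a b by (simp add: t_def c_def)
  have htc: "h (t a) - h (t b) = h (c a) - h (c b)" for a b
    by (metis tdiff c.hom_minus h.hom_minus)
  have epc: "map_poly e (map_poly c p) = p" for p
    by (simp add: map_poly_map_poly o_def ect)
  have inj_t: "inj (\<lambda>a. h (t a))" by (auto simp: inj_def t_def)
  have inj_c: "inj (\<lambda>a. h (c a))" by (auto simp: inj_def)
  have hc_div: "h (c (1 / a)) = 1 / h (c a)" for a
  proof (cases "a = 0")
    case False
    then have "h (c (1 / a)) * h (c a) = 1" by (simp flip: h.hom_mult c.hom_mult)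
    then show ?thesis by (metis mult_zero_right nonzero_eq_divide_eq zero_neq_one)
  qed simp
  \<comment> \<open>P is the Sylvester sum of the deformed problem, written without division by polynomials in t.\<close>
  define D where "D S T = diff_prod S (X - S) * diff_prod T (Y - T)" for S T
  define N where "N S T = (\<Prod>a\<in>X - S. poly (map_poly c g0) (t a))
      * (\<Prod>b\<in>Y - T. (-1) ^ degree f0 * poly (map_poly c f0) (c b))
      * (\<Prod>a\<in>X - S. \<Prod>b\<in>Y - T. t a - c b)" for S T
  define P where "P = (\<Sum>S\<in>ksubsets X (d - degree f0). \<Sum>T\<in>ksubsets Y (degree f0).
     smult (c (1 / D S T) * N S T) ((\<Prod>a\<in>S. [:- t a, 1:]) * (\<Prod>b\<in>T. [:- c b, 1:])))"
  define F where "F = map_poly c f0 * (\<Prod>a\<in>X. [:- t a, 1:])"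
  define G where "G = map_poly c g0 * (\<Prod>b\<in>Y. [:- c b, 1:])"
  define s where "s = (d - degree f0) * (degree f0 + card X - d)"
  let ?f = "map_poly h (map_poly c f0)" and ?g = "map_poly h (map_poly c g0)"
  let ?X = "(\<lambda>a. h (t a)) ` X" and ?Y = "(\<lambda>b. h (c b)) ` Y"
  have deg0: "degree ?f = degree f0" "degree ?g = degree g0" by simp_all
  have monic0: "lead_coeff ?f = 1" "lead_coeff ?g = 1" using monic by simp_all

  have hF: "map_poly h F = ?f * root_poly ?X" "map_poly h G = ?g * root_poly ?Y"
    unfolding F_def G_def root_poly_def
    by (simp_all add: hom_distribs prod.reindex inj_on_subset[OF inj_t] inj_on_subset[OF inj_c])
  have eF: "map_poly e F = f0 * root_poly X" "map_poly e G = g0 * root_poly Y"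
    unfolding F_def G_def root_poly_def by (simp_all add: hom_distribs epc ect)
  have card: "card ?X = card X" "card ?Y = card Y"
    by (simp_all add: card_image inj_on_subset[OF inj_t] inj_on_subset[OF inj_c])
  have disj: "?X \<inter> ?Y = {}" by (auto simp: t_def c_def)
  have degF: "degree F = degree f0 + card X" "degree G = degree g0 + card Y"
    using hF[THEN arg_cong[of _ _ degree]] by (simp_all add: degree_mult_root_poly[OF monic0(1)]
        degree_mult_root_poly[OF monic0(2)] card)
  have e_poly: "e (poly (map_poly c p) x) = poly p (e x)" for p x
    by (simp add: epc flip: e.poly_map_poly)
  have diff_t: "diff_prod ((\<lambda>a. h (t a)) ` S) ((\<lambda>a. h (t a)) ` S') = h (c (diff_prod S S'))" for S S'
    unfolding diff_prod_def
    by (simp add: hom_distribs prod.reindex inj_on_subset[OF inj_t] htc)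
  have diff_c: "diff_prod ((\<lambda>a. h (c a)) ` T) ((\<lambda>a. h (c a)) ` T') = h (c (diff_prod T T'))" for T T'
    unfolding diff_prod_def
    by (simp add: hom_distribs prod.reindex inj_on_subset[OF inj_c])
  have diff_tc: "diff_prod ((\<lambda>a. h (t a)) ` S) ((\<lambda>a. h (c a)) ` T) = h (\<Prod>a\<in>S. \<Prod>b\<in>T. t a - c b)" for S T
    unfolding diff_prod_def
    by (simp add: hom_distribs prod.reindex inj_on_subset[OF inj_c] inj_on_subset[OF inj_t])
  have coeff: "sylv_coeff ?f ?g ?X ?Y ((\<lambda>a. h (t a)) ` S) ((\<lambda>b. h (c b)) ` T) = h (c (1 / D S T) * N S T)"
    for S T
    unfolding sylv_coeff_def image_set_diff[OF inj_t, symmetric] image_set_diff[OF inj_c, symmetric]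
      diff_t diff_c diff_tc D_def N_def
    by (simp add: hom_distribs hc_div prod.reindex inj_on_subset[OF inj_t] inj_on_subset[OF inj_c])
  have root_t: "root_poly ((\<lambda>a. h (t a)) ` S) = (\<Prod>a\<in>S. [:- h (t a), 1:])" for S
    unfolding root_poly_def by (simp add: prod.reindex inj_on_subset[OF inj_t])
  have root_c: "root_poly ((\<lambda>a. h (c a)) ` S) = (\<Prod>a\<in>S. [:- h (c a), 1:])" for S
    unfolding root_poly_def by (simp add: prod.reindex inj_on_subset[OF inj_c])
  have eP: "map_poly e P = sylv_poly d f0 g0 X Y"
    by (simp add: P_def sylv_poly_def sylv_coeff_def root_poly_def diff_prod_def N_def D_def
        hom_distribs epc ect e_poly)
  have hP: "map_poly h P = sylv_poly d ?f ?g ?X ?Y"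
    unfolding P_def sylv_poly_def deg0 sum_ksubsets_image[OF inj_t] sum_ksubsets_image[OF inj_c]
      ph.hom_sum
    by (intro sum.cong refl) (simp add: hom_distribs coeff root_t root_c)
  have "map_poly h (subresultant d F G) = subresultant d (map_poly h F) (map_poly h G)"
    by (rule h.subresultant_hom)
  also have "\<dots> = smult ((-1) ^ s) (sylv_poly d ?f ?g ?X ?Y)"
    unfolding hF s_def
    using d fin disj card monic
    by (subst subresultant_eq_sylv_poly_disjoint[THEN conjunct2, rule_format])
      (simp_all add: deg0 monic0)
  also have "\<dots> = map_poly h (smult ((-1) ^ s) P)"
    by (simp add: hP hom_distribs)
  finally have "subresultant d F G = smult ((-1) ^ s) P" by (rule ph.injectivity)
  then have "map_poly e (subresultant d F G) = smult ((-1) ^ s) (sylv_poly d f0 g0 X Y)"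
    by (simp add: eP hom_distribs)
  moreover have "map_poly e (subresultant d F G) = subresultant d (map_poly e F) (map_poly e G)"
    by (rule e.map_poly_subresultant) (simp_all add: eF degF degree_mult_root_poly monic)
  ultimately show ?thesis by (simp add: eF s_def)
qed

section \<open>The Sylvester sum of multisets\<close>

lemma root_diff_prod_mset_set:
  "root_diff_prod (mset_set X) (mset_set Y) = diff_prod X Y"
  by (simp add: root_diff_prod_def diff_prod_def prod_unfold_prod_mset)

lemma root_diff_poly_mset_set:
  "root_diff_poly (mset_set X) = root_poly X"
  by (simp add: root_diff_poly_def root_diff_prod_def root_poly_def prod_unfold_prod_mset
      image_mset.compositionality o_def)

lemma root_diff_prod_left:
  "root_diff_prod A (mset_set Y) =
     (\<Prod>b\<in>Y. (-1) ^ size A * poly (\<Prod>a\<in>#A. [:- a, 1:]) b)"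
proof -
  have "(\<Prod>a\<in>#A. a - b) = (-1) ^ size A * poly (\<Prod>a\<in>#A. [:- a, 1:]) b" for b
    by (induction A) (simp_all add: algebra_simps)
  moreover have "root_diff_prod A (mset_set Y) = (\<Prod>b\<in>Y. \<Prod>a\<in>#A. a - b)"
    unfolding root_diff_prod_def prod_unfold_prod_mset by (rule prod_mset.swap)
  ultimately show ?thesis by simp
qed

lemma root_diff_prod_right:
  "root_diff_prod (mset_set X) B = (\<Prod>a\<in>X. poly (\<Prod>b\<in>#B. [:- b, 1:]) a)"
proof -
  have "(\<Prod>b\<in>#B. a - b) = poly (\<Prod>b\<in>#B. [:- b, 1:]) a" for a
    by (induction B) (simp_all add: algebra_simps)
  then show ?thesis by (simp add: root_diff_prod_def prod_unfold_prod_mset)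
qed

lemma root_diff_prod_add_right:
  "root_diff_prod A (B + C) = root_diff_prod A B * root_diff_prod A C"
  by (simp add: root_diff_prod_def prod_mset.distrib)

lemma monic_root_product:
  fixes A :: "'a :: idom multiset"
  shows "lead_coeff (\<Prod>a\<in>#A. [:- a, 1:]) = 1" "degree (\<Prod>a\<in>#A. [:- a, 1:]) = size A"
    "{x. poly (\<Prod>a\<in>#A. [:- a, 1:]) x = 0} = set_mset A"
proof -
  have "lead_coeff (\<Prod>a\<in>#A. [:- a, 1:]) = 1 \<and> degree (\<Prod>a\<in>#A. [:- a, 1:]) = size A"
  proof (induction A)
    case (add a A)
    moreover from add have "(\<Prod>a\<in>#A. [:- a, 1:]) \<noteq> 0" by auto
    ultimately show ?case
      by (simp only: image_mset_add_mset prod_mset.add_mset lead_coeff_mult) (subst degree_mult_eq, auto)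
  qed simp
  then show "lead_coeff (\<Prod>a\<in>#A. [:- a, 1:]) = 1" "degree (\<Prod>a\<in>#A. [:- a, 1:]) = size A" by auto
  show "{x. poly (\<Prod>a\<in>#A. [:- a, 1:]) x = 0} = set_mset A"
    by (induction A) (auto simp: algebra_simps)
qed

lemma minus_one_power_mult:
  "(-1) ^ k * p = smult ((-1) ^ k) (p :: 'a :: comm_ring_1 poly)"
  by (simp add: minus_one_power_iff)

text \<open>
  The two numerators of the Sylvester sum are regrouped: \<open>B - mset_set T\<close> is \<open>B0\<close> together with
  \<open>Y - T\<close>, and the products over the multisets \<open>A0\<close> and \<open>B0\<close> are values of the cofactors.
\<close>

lemma SylM_eq_sylv_poly:
  fixes A0 B0 :: "'a :: field multiset"
  assumes fin: "finite X" "finite Y"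
  shows "SylM X Y d (A0 + mset_set X) (B0 + mset_set Y)
    = smult ((-1) ^ (size A0 * (size A0 + card X - d)))
        (sylv_poly d (\<Prod>a\<in>#A0. [:- a, 1:]) (\<Prod>b\<in>#B0. [:- b, 1:]) X Y)"
proof -
  have "root_diff_prod A0 (mset_set (Y - T)) * root_diff_prod (mset_set (X - S)) (B0 + mset_set Y - mset_set T)
      / (root_diff_prod (mset_set S) (mset_set (X - S)) * root_diff_prod (mset_set T) (mset_set (Y - T)))
      = sylv_coeff (\<Prod>a\<in>#A0. [:- a, 1:]) (\<Prod>b\<in>#B0. [:- b, 1:]) X Y S T"
    if "S \<subseteq> X" "T \<subseteq> Y" for S T
  proof -
    have "B0 + mset_set Y - mset_set T = B0 + mset_set (Y - T)"
      using mset_set_Diff[OF fin(2) that(2)] that fin by (simp add: msubset_mset_set_iff finite_subset)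
    then show ?thesis
      by (simp only: root_diff_prod_add_right root_diff_prod_right[of _ B0] root_diff_prod_left[of A0]
          root_diff_prod_mset_set sylv_coeff_def monic_root_product(2) mult_ac)
  qed
  then have "(\<Sum>S\<in>ksubsets X (d - size A0). \<Sum>T\<in>ksubsets Y (size A0).
      smult (root_diff_prod A0 (mset_set (Y - T)) * root_diff_prod (mset_set (X - S)) (B0 + mset_set Y - mset_set T)
        / (root_diff_prod (mset_set S) (mset_set (X - S)) * root_diff_prod (mset_set T) (mset_set (Y - T))))
       (root_diff_poly (mset_set S) * root_diff_poly (mset_set T)))
     = sylv_poly d (\<Prod>a\<in>#A0. [:- a, 1:]) (\<Prod>b\<in>#B0. [:- b, 1:]) X Y"
    unfolding sylv_poly_def monic_root_product(2) root_diff_poly_mset_set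
    by (intro sum.cong refl arg_cong2[of _ _ _ _ smult]) blast
  then show ?thesis
    by (simp only: SylM_def Let_def size_union size_mset_set add_diff_cancel_right' minus_one_power_mult)
qed

lemma subresultant_eq_SylM:
  fixes A0 B0 :: "'a :: field multiset"
  assumes fin: "finite X" "finite Y"
    and d: "size A0 + size B0 \<le> d" "d \<le> size A0 + card X" "d \<le> size B0 + card Y"
      "\<not> (size A0 + card X = d \<and> size B0 + card Y = d)"
  shows "subresultant d (\<Prod>a\<in>#A0 + mset_set X. [:- a, 1:]) (\<Prod>b\<in>#B0 + mset_set Y. [:- b, 1:])
    = (-1) ^ (d * (size A0 + card X - d)) * SylM X Y d (A0 + mset_set X) (B0 + mset_set Y)"
proof -
  let ?k = "size A0 + card X - d"
  have sign: "(-1) ^ ((d - size A0) * ?k) = (-1) ^ (d * ?k) * ((-1) ^ (size A0 * ?k) :: 'a)"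
  proof -
    have cancel: "(-1) ^ (q * k) = (-1) ^ ((p + q) * k) * ((-1) ^ (p * k) :: 'a)" for p q k :: nat
      by (simp add: add_mult_distrib power_add minus_one_power_iff)
    show ?thesis using cancel[of "d - size A0" ?k "size A0"] d(1) by simp
  qed
  have "subresultant d ((\<Prod>a\<in>#A0. [:- a, 1:]) * root_poly X) ((\<Prod>b\<in>#B0. [:- b, 1:]) * root_poly Y)
    = smult ((-1) ^ ((d - size A0) * ?k))
        (sylv_poly d (\<Prod>a\<in>#A0. [:- a, 1:]) (\<Prod>b\<in>#B0. [:- b, 1:]) X Y)"
    by (rule subresultant_eq_sylv_poly
          [OF monic_root_product(1) monic_root_product(1) fin, unfolded monic_root_product(2), OF d])
  then show ?thesis
    by (simp only: SylM_eq_sylv_poly[OF fin] minus_one_power_mult smult_smult sign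
        image_mset_union prod_mset_Un root_poly_def prod_unfold_prod_mset)
qed

theorem theorem1p2:
  fixes f g :: "'a :: field poly"
    and A B :: "'a multiset"
    and Abar Bbar :: "'a set"
    and m n m' n' d :: nat
  assumes "lead_coeff f = 1" and "degree f = m"
    and "lead_coeff g = 1" and "degree g = n"
    and "f = (\<Prod>a\<in>#A. [:- a, 1:])"
    and "g = (\<Prod>b\<in>#B. [:- b, 1:])"
    and "Abar \<subseteq> {a. poly f a = 0}"
    and "Bbar \<subseteq> {b. poly g b = 0}"
    and "m' = m - card Abar"
    and "n' = n - card Bbar"
    and "(m \<noteq> n \<and> m' + n' \<le> d \<and> d \<le> min m n) \<or> (m = n \<and> m' + n' \<le> d \<and> d < m)"
  shows "subresultant d f g = (-1) ^ (d * (m - d)) * SylM Abar Bbar d A B"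
proof -
  define A0 B0 where "A0 = A - mset_set Abar" and "B0 = B - mset_set Bbar"
  have sub: "Abar \<subseteq> set_mset A" "Bbar \<subseteq> set_mset B"
    using assms(5-8) monic_root_product(3)[of A] monic_root_product(3)[of B] by simp_all
  then have fin: "finite Abar" "finite Bbar" by (auto intro: finite_subset)
  have le: "mset_set Abar \<subseteq># A" "mset_set Bbar \<subseteq># B"
    using sub by (auto simp: subseteq_mset_def count_mset_set' Suc_le_eq count_greater_zero_iff)
  then have AB: "A = A0 + mset_set Abar" "B = B0 + mset_set Bbar"
    by (simp_all add: A0_def B0_def)
  have m: "m = size A0 + card Abar" "n = size B0 + card Bbar"
    using assms(2,4-6) monic_root_product(2)[of A] monic_root_product(2)[of B] AB by simp_all
  have "subresultant d f g = (-1) ^ (d * (size A0 + card Abar - d)) * SylM Abar Bbar d A B"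
    unfolding assms(5,6) AB
    by (rule subresultant_eq_SylM[OF fin]) (use assms(9-11) m in auto)
  then show ?thesis by (simp add: m)
qed

end
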